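(* Let $m,n$ be positive integers and let $C$ be a directed cycle in $G^{m,n}_2$. Suppose $C$ is obtained from directed cycles $C_1$ and $C_2$ by gluing along edges $A_1\to B_1$ in $C_1$ and $A_2\to B_2$ in $C_2$, where $A_1,A_2\subset[m]$ and $B_1,B_2\subset[n]$ and the cardinalities of $A_1,B_1,A_2,B_2$ all have the same parity. Let $F_1$ be the facet of $\mathrm{GCut}(D_{m,n})$ corresponding to $C_1$, with facet-defining inequality $\mathbf q_1\cdot\mathbf x\le c_1$, and let $F_2$ be the facet of $\mathrm{GCut}(D_{m,n})$ corresponding to $C_2$, with facet-defining inequality $\mathbf q_2\cdot\mathbf x\le 0$ (inequalities normalized as described in the context). Then the facet-defining inequality for the co-facet given by $C$ is $$\mathbf q_1\cdot\mathbf x+\mathbf q_2\cdot\mathbf x+\mathbf a\cdot\mathbf x\le c_1,$$ where $\mathbf a$ is the linear functional $$\mathbf a\cdot\mathbf x=\sum_{S\in\mathcal P_1}x_S+\sum_{S\in\mathcal P_2}x_S-\sum_{S\in\mathcal N_1}x_S-\sum_{S\in\mathcal N_2}x_S$$ and, with $S$ ranging over subsets of $[m]\sqcup[n]$, - $\mathcal P_1$ is the set of $S$ with $\#(S\cap A_1)$ odd, $\#(S\cap B_1)$ even, $\#(S\cap A_2)$ even, $\#(S\cap B_2)$ odd; - $\mathcal P_2$ is the set of $S$ with $\#(S\cap A_1)$ even, $\#(S\cap B_1)$ odd, $\#(S\cap A_2)$ odd, $\#(S\cap B_2)$ even; - $\mathcal N_1$ is the set of $S$ with $\#(S\cap A_1)$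 odd, $\#(S\cap B_1)$ odd, $\#(S\cap A_2)$ even, $\#(S\cap B_2)$ even; - $\mathcal N_2$ is the set of $S$ with $\#(S\cap A_1)$ even, $\#(S\cap B_1)$ even, $\#(S\cap A_2)$ odd, $\#(S\cap B_2)$ odd. One always has $c_1=2^{m+n-3}$ or $c_1=0$. Furthermore, for all $S\subset[m]\sqcup[n]$, the value $(\mathbf q_1+\mathbf q_2+\mathbf a)\cdot\mathbf d^S$ is either $c_1$ or $c_1-2^{m+n-3}$.
   Context: $D_{m,n}=\{S\sqcup T : S\subsetneq[m],\ T\subsetneq[n]\}$ is a simplicial complex on the ground set $[m]\sqcup[n]$ (it is the Alexander dual of the disjoint union of two simplices $2^{[m]}\sqcup 2^{[n]}$); $\overline{D_{m,n}}$ denotes its set of nonempty faces. Its generalized cut polytope is $\mathrm{GCut}(D_{m,n})=\mathrm{conv}\{\mathbf d^S : S\subset[m]\sqcup[n]\}\subset\mathbb R^{\overline{D_{m,n}}}$, where for $F\in\overline{D_{m,n}}$, $d^S_F=1$ if $\#(F\cap S)$ is odd and $d^S_F=0$ if it is even. It is full-dimensional. All sets $S$ indexing the four sums defining $\mathbf a$ are elements of $\overline{D_{m,n}}$. $G^{m,n}_2$ is the orientation of the complete bipartite graph $K_{2^m,2^n}$ whose two vertex classes are the subsets $A\subset[m]$ and the subsets $B\subset[n]$, with the edge between $A$ and $B$ directed $A\to B$ if $\#A+\#B$ is even and $B\to A$ if $\#A+\#B$ is odd. The edge between $A$ and $B$ is identified with the set $A\sqcup B\subset[m]\sqcup[n]$;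 $\overrightarrow{A\sqcup B}$ and $\overleftarrow{A\sqcup B}$ record the directions $A\to B$ and $B\to A$. It is a known fact (from the oriented matroid of the Gale dual) that facets of $\mathrm{GCut}(D_{m,n})$ correspond bijectively to directed cycles of $G_2^{m,n}$: the cycle with edge set $C$ corresponds to the facet whose co-facet is $C$, i.e. $\mathbf d^S$ is not on the facet exactly for $S\in C$. Gluing: let $C_1,C_2$ be disjoint directed cycles in $G^{m,n}_2$ (no common vertices), one of which has length 4, let $\overrightarrow{A_1\sqcup B_1}$ be an edge of $C_1$ and $\overrightarrow{A_2\sqcup B_2}$ an edge of $C_2$, with the cardinalities of $A_1,B_1,A_2,B_2$ all of the same parity. The cycle obtained by gluing $C_1$ and $C_2$ along these edges is $$C=\left(C_1\cup C_2\cup\{\overrightarrow{A_1\sqcup B_2},\overrightarrow{A_2\sqcup B_1}\}\right)\setminus\{\overrightarrow{A_1\sqcup B_1},\overrightarrow{A_2\sqcup B_2}\}.$$ Normalization: because the polytope is full-dimensional, the facet-defining inequality $\mathbf q\cdot\mathbf x\le c$ of a co-facet is unique up to a positive scalar; "the" facet-defining inequality is the one scaled so that $\max_{S}(c-\mathbf q\cdot\mathbf d^S)=2^{m+n-3}$.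
   Formalization: The claims on the inequality for C and its values are proved only if none of A1⊔B1, A1⊔B2, A2⊔B1 is empty; otherwise they fail: as d^∅=0, the constant for C is 2^{m+n-3} or 0 according to whether ∅ is in C, and so differs from c1 (e.g. A1=B1=∅). That c1 is 2^{m+n-3} or 0 is proved always. *)

theory Defs
  imports "HOL-Analysis.Analysis" "Graph_Theory.Arc_Walk"
begin

text \<open>
  The sets $[m]$ and $[n]$ are the universes of finite types \<open>'m\<close> and \<open>'n\<close> with
  $m = $ \<open>CARD('m)\<close> and $n = $ \<open>CARD('n)\<close>, and $[m] \sqcup [n]$ is the universe of \<open>'m + 'n\<close>;
  the set $A \sqcup B$ is \<open>A <+> B\<close>.
\<close>

definition D_complex :: "('m + 'n) set set" where
  "D_complex = {S <+> T | S T. S \<subset> UNIV \<and> T \<subset> UNIV}"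

definition nonempty_faces :: "'a set set \<Rightarrow> 'a set set" where
  "nonempty_faces K = K - {{}}"

text \<open>
  The space of real vectors indexed by the nonempty faces of \<open>K\<close> is realised as the coordinate
  subspace of \<open>real ^ 'a set\<close> on which all other coordinates vanish. Points and functionals
  are both taken from this subspace.
\<close>

definition face_space :: "'a::finite set set \<Rightarrow> (real ^ 'a set) set" where
  "face_space K = {x. \<forall>F. F \<notin> nonempty_faces K \<longrightarrow> x $ F = 0}"

definition cut_vector :: "'a::finite set set \<Rightarrow> 'a set \<Rightarrow> real ^ 'a set" where
  "cut_vector K S = (\<chi> F. if F \<in> nonempty_faces K \<and> odd (card (F \<inter> S)) then 1 else 0)"

definition GCut :: "'a::finite set set \<Rightarrow> (real ^ 'a set) set" where
  "GCut K = convex hull (range (cut_vector K))"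

definition cofacet :: "'a::finite set set \<Rightarrow> (real ^ 'a set) set \<Rightarrow> 'a set set" where
  "cofacet K F = {S. cut_vector K S \<notin> F}"

text \<open>
  \<open>F\<close> is a facet and \<open>q \<bullet> x \<le> c\<close> is an inequality defining it. The inequality is determined
  only up to a positive factor; see \<open>normalized\<close>.
\<close>

definition facet_defining ::
    "'a::finite set set \<Rightarrow> (real ^ 'a set) set \<Rightarrow> real ^ 'a set \<Rightarrow> real \<Rightarrow> bool" where
  "facet_defining K F q c \<longleftrightarrow>
     F facet_of GCut K \<and> q \<in> face_space K \<and>
     (\<forall>x\<in>GCut K. q \<bullet> x \<le> c) \<and> F = {x \<in> GCut K. q \<bullet> x = c}"

text \<open>
  The number $2^{m+n-3}$, with an integer exponent because $m + n - 3 = -1$ for $m = n = 1$.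
  The argument serves only to determine the two types.
\<close>

definition slack_scale :: "('m::finite + 'n::finite) itself \<Rightarrow> real" where
  "slack_scale _ = 2 powi (int CARD('m) + int CARD('n) - 3)"

definition normalized ::
    "('m::finite + 'n::finite) set set \<Rightarrow> real ^ ('m + 'n) set \<Rightarrow> real \<Rightarrow> bool" where
  "normalized K q c \<longleftrightarrow>
     Max (range (\<lambda>S. c - q \<bullet> cut_vector K S)) = slack_scale TYPE('m + 'n)"

text \<open>
  The orientation of the complete bipartite graph between the subsets of $[m]$ (tagged \<open>Inl\<close>)
  and those of $[n]$ (tagged \<open>Inr\<close>). An arc is identified with the set $A \sqcup B$ formed
  from its ends \<open>A = Inl -` S\<close> and \<open>B = Inr -` S\<close>, so every subset of $[m] \sqcup [n]$ is an arc,
  and sets of arcs can be compared directly with co-facets.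
\<close>

definition G2 :: "('m set + 'n set, ('m::finite + 'n::finite) set) pre_digraph" where
  "G2 = \<lparr> verts = UNIV, arcs = UNIV,
     tail = (\<lambda>S. if even (card (Inl -` S) + card (Inr -` S)) then Inl (Inl -` S) else Inr (Inr -` S)),
     head = (\<lambda>S. if even (card (Inl -` S) + card (Inr -` S)) then Inr (Inr -` S) else Inl (Inl -` S)) \<rparr>"

definition directed_cycle :: "('m::finite + 'n::finite) set set \<Rightarrow> bool" where
  "directed_cycle C \<longleftrightarrow> (\<exists>p. pre_digraph.cycle G2 p \<and> C = set p)"

definition cycle_verts :: "('m::finite + 'n::finite) set set \<Rightarrow> ('m set + 'n set) set" where
  "cycle_verts C = tail G2 ` C \<union> head G2 ` C"

text \<open>
  \<open>C\<close> is obtained by gluing \<open>C\<^sub>1\<close> and \<open>C\<^sub>2\<close> along \<open>A\<^sub>1 \<rightarrow> B\<^sub>1\<close> and \<open>A\<^sub>2 \<rightarrow> B\<^sub>2\<close>. By the parity condition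
  all four of the arcs \<open>A\<^sub>i <+> B\<^sub>j\<close> are directed from \<open>A\<^sub>i\<close> to \<open>B\<^sub>j\<close>.
\<close>

definition glued_along ::
    "('m::finite + 'n::finite) set set \<Rightarrow> ('m + 'n) set set \<Rightarrow> ('m + 'n) set set \<Rightarrow>
     'm set \<Rightarrow> 'n set \<Rightarrow> 'm set \<Rightarrow> 'n set \<Rightarrow> bool" where
  "glued_along C C\<^sub>1 C\<^sub>2 A\<^sub>1 B\<^sub>1 A\<^sub>2 B\<^sub>2 \<longleftrightarrow>
     directed_cycle C\<^sub>1 \<and> directed_cycle C\<^sub>2 \<and>
     cycle_verts C\<^sub>1 \<inter> cycle_verts C\<^sub>2 = {} \<and>
     (card C\<^sub>1 = 4 \<or> card C\<^sub>2 = 4) \<and>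
     A\<^sub>1 <+> B\<^sub>1 \<in> C\<^sub>1 \<and> A\<^sub>2 <+> B\<^sub>2 \<in> C\<^sub>2 \<and>
     (even (card A\<^sub>1) \<longleftrightarrow> even (card B\<^sub>1)) \<and>
     (even (card A\<^sub>1) \<longleftrightarrow> even (card A\<^sub>2)) \<and>
     (even (card A\<^sub>1) \<longleftrightarrow> even (card B\<^sub>2)) \<and>
     C = (C\<^sub>1 \<union> C\<^sub>2 \<union> {A\<^sub>1 <+> B\<^sub>2, A\<^sub>2 <+> B\<^sub>1}) - {A\<^sub>1 <+> B\<^sub>1, A\<^sub>2 <+> B\<^sub>2}"

definition P1 :: "'m set \<Rightarrow> 'n set \<Rightarrow> 'm set \<Rightarrow> 'n set \<Rightarrow> ('m + 'n) set set" where
  "P1 A\<^sub>1 B\<^sub>1 A\<^sub>2 B\<^sub>2 = {S. odd (card (S \<inter> Inl ` A\<^sub>1)) \<and> even (card (S \<inter> Inr ` B\<^sub>1)) \<and>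
                          even (card (S \<inter> Inl ` A\<^sub>2)) \<and> odd (card (S \<inter> Inr ` B\<^sub>2))}"

definition P2 :: "'m set \<Rightarrow> 'n set \<Rightarrow> 'm set \<Rightarrow> 'n set \<Rightarrow> ('m + 'n) set set" where
  "P2 A\<^sub>1 B\<^sub>1 A\<^sub>2 B\<^sub>2 = {S. even (card (S \<inter> Inl ` A\<^sub>1)) \<and> odd (card (S \<inter> Inr ` B\<^sub>1)) \<and>
                          odd (card (S \<inter> Inl ` A\<^sub>2)) \<and> even (card (S \<inter> Inr ` B\<^sub>2))}"

definition N1 :: "'m set \<Rightarrow> 'n set \<Rightarrow> 'm set \<Rightarrow> 'n set \<Rightarrow> ('m + 'n) set set" where
  "N1 A\<^sub>1 B\<^sub>1 A\<^sub>2 B\<^sub>2 = {S. odd (card (S \<inter> Inl ` A\<^sub>1)) \<and> odd (card (S \<inter> Inr ` B\<^sub>1)) \<and>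
                          even (card (S \<inter> Inl ` A\<^sub>2)) \<and> even (card (S \<inter> Inr ` B\<^sub>2))}"

definition N2 :: "'m set \<Rightarrow> 'n set \<Rightarrow> 'm set \<Rightarrow> 'n set \<Rightarrow> ('m + 'n) set set" where
  "N2 A\<^sub>1 B\<^sub>1 A\<^sub>2 B\<^sub>2 = {S. even (card (S \<inter> Inl ` A\<^sub>1)) \<and> even (card (S \<inter> Inr ` B\<^sub>1)) \<and>
                          odd (card (S \<inter> Inl ` A\<^sub>2)) \<and> odd (card (S \<inter> Inr ` B\<^sub>2))}"

text \<open>The coefficient vector of the functional $\mathbf a$; \<open>axis S 1 \<bullet> x\<close> is the coordinate \<open>x $ S\<close>.\<close>

definition gluing_functional ::
    "'m::finite set \<Rightarrow> 'n::finite set \<Rightarrow> 'm set \<Rightarrow> 'n set \<Rightarrow> real ^ ('m + 'n) set" where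
  "gluing_functional A\<^sub>1 B\<^sub>1 A\<^sub>2 B\<^sub>2 =
     (\<Sum>S\<in>P1 A\<^sub>1 B\<^sub>1 A\<^sub>2 B\<^sub>2. axis S 1) + (\<Sum>S\<in>P2 A\<^sub>1 B\<^sub>1 A\<^sub>2 B\<^sub>2. axis S 1)
     - (\<Sum>S\<in>N1 A\<^sub>1 B\<^sub>1 A\<^sub>2 B\<^sub>2. axis S 1) - (\<Sum>S\<in>N2 A\<^sub>1 B\<^sub>1 A\<^sub>2 B\<^sub>2. axis S 1)"

text \<open>
  The gluing exchanges the arcs \<open>A\<^sub>1 <+> B\<^sub>1\<close>, \<open>A\<^sub>2 <+> B\<^sub>2\<close> for \<open>A\<^sub>1 <+> B\<^sub>2\<close>, \<open>A\<^sub>2 <+> B\<^sub>1\<close>. Because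
  \<open>cut_vector K {} = 0\<close>, the right-hand side of a facet inequality is its slack at the arc \<open>{}\<close>,
  so gluing keeps the right-hand side only if \<open>{}\<close> is not among the exchanged arcs.
  That \<open>A\<^sub>2 <+> B\<^sub>2\<close> is nonempty need not be required when the right-hand side for \<open>C\<^sub>2\<close> is 0.
\<close>

definition keeps_empty_arc :: "'m set \<Rightarrow> 'n set \<Rightarrow> 'm set \<Rightarrow> 'n set \<Rightarrow> bool" where
  "keeps_empty_arc A\<^sub>1 B\<^sub>1 A\<^sub>2 B\<^sub>2 \<longleftrightarrow> {} \<notin> {A\<^sub>1 <+> B\<^sub>1, A\<^sub>1 <+> B\<^sub>2, A\<^sub>2 <+> B\<^sub>1}"

end

theory Submission
  imports Defs
begin

text \<open>
  Attach to an inequality $q \cdot x \le c$ its slack $s(S) = c - q \cdot d^S$ at the vertices of the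
  cut polytope. As $d^S_F = (1 - (-1)^{|F \cap S|})/2$, the slack functions are exactly the functions
  on the group of subsets of $[m] \sqcup [n]$ whose Fourier expansion uses only faces of $D_{m,n}$.
  A face omits a point of $[m]$ and a point of $[n]$, and toggling an omitted point of $[n]$ (or of
  $[m]$) does not change the character of that face. Hence the alternating sums of $s$ over all
  $A \sqcup B$ with $A$ fixed, or with $B$ fixed, vanish
  (\<open>alternating_slack_left\<close>, \<open>alternating_slack_right\<close>). In terms of the graph $G^{m,n}_2$
  this is Kirchhoff's law: $s$ is a circulation (\<open>circulation_slack\<close>).

  A circulation that vanishes off a directed cycle is constant on that cycle
  (\<open>circulation_on_cycle\<close>), since each vertex of the cycle has a single arc entering and
  a single arc leaving. So the normalized slack of a facet with co-facet $C$ is $2^{m+n-3}$ times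
  the indicator of $C$ (\<open>facet_slack_on_cycle\<close>). Conversely an inequality whose slack is a
  positive multiple of this indicator defines a facet, provided that $C$ omits some arc
  (\<open>facet_defining_if_slack_on_cycle\<close>): it cuts out a nonempty proper face, which lies in some
  facet, and the slack of that facet is a circulation vanishing off $C$, so it is proportional to
  the given one and the two faces coincide.

  What remains is to see that adding $\mathbf a$ to $q_1 + q_2$ changes the slack as gluing changes the set
  of arcs. The coefficient of $\mathbf a$ at $F$ is a quarter of a product of two differences of characters,
  one in $A_1, A_2$ and one in $B_1, B_2$; expanded, it is a combination of the four characters of
  the exchanged arcs. By orthogonality of characters $\mathbf a \cdot d^S$ is therefore, up to an
  additive constant, a combination of the point masses at these four arcs
  (\<open>gluing_functional_cut_vector\<close>).

  Since $d^\emptyset = 0$, the right-hand side of an inequality is its slack at the arc $\emptyset$. So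
  $c_1$ can only be $0$ or $2^{m+n-3}$, and the additive constant is $0$ when $\emptyset$ is none of the
  exchanged arcs.
\<close>

section \<open>Parity characters\<close>

text \<open>The characters of the group of subsets under symmetric difference.\<close>

definition parity_character :: "'a set \<Rightarrow> 'a set \<Rightarrow> real" where
  "parity_character F S = (-1) ^ card (F \<inter> S)"

lemma parity_character_if:
  "parity_character F S = (if even (card (F \<inter> S)) then 1 else -1)"
  by (simp add: parity_character_def)

lemma parity_character_empty [simp]: "parity_character F {} = 1"
  by (simp add: parity_character_def)

lemma even_card_toggle:
  assumes "finite X"
  shows "even (card (sym_diff X {t})) \<longleftrightarrow> odd (card X)"
proof (cases "t \<in> X")
  case True
  then have "sym_diff X {t} = X - {t}" "card X = Suc (card (X - {t}))"
    using card.remove[OF assms] by auto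
  then show ?thesis by simp
next
  case False
  then have "sym_diff X {t} = insert t X" by auto
  then show ?thesis using False assms by simp
qed

lemma parity_character_toggle:
  fixes F S :: "'a::finite set"
  shows "parity_character (sym_diff F {t}) S =
    (if t \<in> S then - parity_character F S else parity_character F S)"
proof (cases "t \<in> S")
  case True
  then have "sym_diff F {t} \<inter> S = sym_diff (F \<inter> S) {t}" by auto
  with True show ?thesis
    by (simp only: parity_character_if even_card_toggle[OF finite]) simp
next
  case False
  then have "sym_diff F {t} \<inter> S = F \<inter> S" by auto
  with False show ?thesis
    by (simp only: parity_character_if) simp
qed

lemma sum_toggle_eq_0:
  fixes f :: "'a::finite set \<Rightarrow> real"
  assumes "\<And>X. f (sym_diff X {t}) = - f X"
  shows "(\<Sum>X\<in>UNIV. f X) = 0"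
proof -
  have "(\<Sum>X\<in>UNIV. f X) = (\<Sum>X\<in>UNIV. f (sym_diff X {t}))"
    by (rule sum.reindex_bij_witness[of _ "\<lambda>X. sym_diff X {t}" "\<lambda>X. sym_diff X {t}"])
      (auto intro: arg_cong[where f = f])
  also have "\<dots> = - (\<Sum>X\<in>UNIV. f X)"
    by (simp only: assms sum_negf)
  finally show ?thesis by simp
qed

lemma alternating_sum_toggle_eq_0:
  fixes g :: "'a::finite set \<Rightarrow> real"
  assumes "\<And>X. g (sym_diff X {t}) = g X"
  shows "(\<Sum>X\<in>UNIV. (-1) ^ card X * g X) = 0"
proof (rule sum_toggle_eq_0[where t = t])
  fix X :: "'a set"
  have "(-1::real) ^ card (sym_diff X {t}) = - ((-1) ^ card X)"
    by (simp only: minus_one_power_iff even_card_toggle[OF finite]) simp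
  then show "(-1) ^ card (sym_diff X {t}) * g (sym_diff X {t}) = - ((-1) ^ card X * g X)"
    by (simp only: assms)
qed

lemma parity_character_orthogonality:
  fixes U V :: "'a::finite set"
  shows "(\<Sum>F\<in>UNIV. parity_character F U * parity_character F V) =
    (if U = V then 2 ^ CARD('a) else 0)"
proof (cases "U = V")
  case True
  have "(\<Sum>F\<in>UNIV. parity_character F V * parity_character F V) = real (card (Pow (UNIV :: 'a set)))"
    by (simp add: parity_character_def flip: power_add)
  also have "\<dots> = 2 ^ CARD('a)"
    by (simp add: card_Pow del: Pow_UNIV)
  finally show ?thesis using True by simp
next
  case False
  then obtain t where "t \<in> U \<longleftrightarrow> t \<notin> V" by auto
  then have "(\<Sum>F\<in>UNIV. parity_character F U * parity_character F V) = 0"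
    by (intro sum_toggle_eq_0[where t = t]) (auto simp only: parity_character_toggle split: if_splits)
  then show ?thesis using False by simp
qed

lemma parity_character_Plus:
  fixes F :: "('m::finite + 'n::finite) set"
  shows "parity_character F (A <+> B) =
    parity_character F (Inl ` A) * parity_character F (Inr ` B)"
proof -
  have "card (F \<inter> (A <+> B)) = card (F \<inter> Inl ` A) + card (F \<inter> Inr ` B)"
    unfolding Plus_def Int_Un_distrib by (rule card_Un_disjoint) auto
  then show ?thesis by (simp add: parity_character_def power_add)
qed

section \<open>Slack functions are circulations\<close>

definition slack :: "real ^ ('m::finite + 'n::finite) set \<Rightarrow> real \<Rightarrow> ('m + 'n) set \<Rightarrow> real" where
  "slack q c S = c - q \<bullet> cut_vector D_complex S"

lemma slack_empty:
  fixes q :: "real ^ ('m::finite + 'n::finite) set"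
  shows "slack q c {} = c"
proof -
  have "cut_vector D_complex {} = (0 :: real ^ ('m + 'n) set)"
    by (simp add: cut_vector_def vec_eq_iff)
  then show ?thesis by (simp add: slack_def)
qed

lemma nonempty_face_omits:
  assumes "F \<in> nonempty_faces (D_complex :: ('m + 'n) set set)"
  obtains a b where "Inl a \<notin> F" "Inr b \<notin> F"
  using assms by (auto simp: nonempty_faces_def D_complex_def psubset_eq)

text \<open>
  The sum is a combination of one alternating sum for each face \<open>F\<close> and one for the constant
  term. Toggling a point reverses the sign, and if the point is chosen so that the \<open>F\<close>-coordinate
  of \<open>d\<^sup>S\<close> does not change, the sum for \<open>F\<close> cancels in pairs. The point may differ from one face
  to the next.
\<close>

lemma alternating_slack:
  fixes q :: "real ^ ('m::finite + 'n::finite) set" and f :: "'z::finite set \<Rightarrow> ('m + 'n) set"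
  assumes "\<And>F. F \<in> nonempty_faces D_complex \<Longrightarrow> \<exists>t. \<forall>X. F \<inter> f (sym_diff X {t}) = F \<inter> f X"
  shows "(\<Sum>X\<in>UNIV. (-1) ^ card X * slack q c (f X)) = 0"
proof -
  let ?d = "\<lambda>F X. cut_vector (D_complex :: ('m + 'n) set set) (f X) $ F"
  have coord: "(\<Sum>X\<in>UNIV. (-1) ^ card X * ?d F X) = 0" for F
  proof (cases "F \<in> nonempty_faces (D_complex :: ('m + 'n) set set)")
    case True
    then obtain t where "\<And>X. F \<inter> f (sym_diff X {t}) = F \<inter> f X"
      using assms by blast
    then show ?thesis
      by (intro alternating_sum_toggle_eq_0[where t = t]) (simp only: cut_vector_def vec_lambda_beta)
  qed (simp add: cut_vector_def)
  have "(\<Sum>X\<in>UNIV. (-1) ^ card X * slack q c (f X)) =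
      (\<Sum>X\<in>(UNIV :: 'z set set). (-1) ^ card X * c) -
      (\<Sum>X\<in>UNIV. \<Sum>F\<in>UNIV. q $ F * ((-1) ^ card X * ?d F X))"
    unfolding slack_def inner_vec_def
    by (simp add: right_diff_distrib sum_subtractf sum_distrib_left mult.left_commute)
  also have "(\<Sum>X\<in>(UNIV :: 'z set set). (-1) ^ card X * c) = 0"
    by (rule alternating_sum_toggle_eq_0) simp
  also have "(\<Sum>X\<in>UNIV. \<Sum>F\<in>UNIV. q $ F * ((-1) ^ card X * ?d F X)) =
      (\<Sum>F\<in>UNIV. q $ F * (\<Sum>X\<in>UNIV. (-1) ^ card X * ?d F X))"
    unfolding sum_distrib_left by (rule sum.swap)
  finally show ?thesis by (simp add: coord)
qed

lemma alternating_slack_left: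
  fixes q :: "real ^ ('m::finite + 'n::finite) set"
  shows "(\<Sum>B\<in>UNIV. (-1) ^ card B * slack q c (A <+> B)) = 0"
proof (rule alternating_slack)
  fix F :: "('m + 'n) set"
  assume "F \<in> nonempty_faces D_complex"
  then obtain b where "Inr b \<notin> F" by (rule nonempty_face_omits)
  then have "F \<inter> (A <+> sym_diff B {b}) = F \<inter> (A <+> B)" for B by auto
  then show "\<exists>b. \<forall>B. F \<inter> (A <+> sym_diff B {b}) = F \<inter> (A <+> B)" by blast
qed

lemma alternating_slack_right:
  fixes q :: "real ^ ('m::finite + 'n::finite) set"
  shows "(\<Sum>A\<in>UNIV. (-1) ^ card A * slack q c (A <+> B)) = 0"
proof (rule alternating_slack)
  fix F :: "('m + 'n) set"
  assume "F \<in> nonempty_faces D_complex"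
  then obtain a where "Inl a \<notin> F" by (rule nonempty_face_omits)
  then have "F \<inter> (sym_diff A {a} <+> B) = F \<inter> (A <+> B)" for A by auto
  then show "\<exists>a. \<forall>A. F \<inter> (sym_diff A {a} <+> B) = F \<inter> (A <+> B)" by blast
qed

definition circulation :: "(('m::finite + 'n::finite) set \<Rightarrow> real) \<Rightarrow> bool" where
  "circulation s \<longleftrightarrow> (\<forall>v. (\<Sum>S | head G2 S = v. s S) = (\<Sum>S | tail G2 S = v. s S))"

lemma Plus_vimage_eq: "Inl -` S <+> Inr -` S = S"
proof (rule set_eqI)
  show "x \<in> Inl -` S <+> Inr -` S \<longleftrightarrow> x \<in> S" for x
    by (cases x) auto
qed

lemma vimage_Plus [simp]: "Inl -` (A <+> B) = A" "Inr -` (A <+> B) = B"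
  by auto

text \<open>
  At the vertex \<open>A\<close> the sign \<open>(-1) ^ (card A + card B)\<close> is 1 on the arcs that leave and -1 on
  those that enter; at the vertex \<open>B\<close> it is the other way round.
\<close>

lemma circulation_slack:
  fixes q :: "real ^ ('m::finite + 'n::finite) set"
  shows "circulation (slack q c)"
  unfolding circulation_def
proof
  fix v :: "'m set + 'n set"
  let ?s = "slack q c"
  have split: "(\<Sum>X\<in>UNIV. (-1) ^ (k + card X) * h X) =
      (\<Sum>X | even (k + card X). h X) - (\<Sum>X | odd (k + card X). h X)"
    for h :: "'z::finite set \<Rightarrow> real" and k
  proof -
    have "(\<Sum>X\<in>UNIV. (-1) ^ (k + card X) * h X) =
        (\<Sum>X | even (k + card X). (-1) ^ (k + card X) * h X) +
        (\<Sum>X | odd (k + card X). (-1) ^ (k + card X) * h X)"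
      by (subst sum.union_disjoint[symmetric]) (auto intro!: sum.cong)
    also have "(\<Sum>X | even (k + card X). (-1) ^ (k + card X) * h X) = (\<Sum>X | even (k + card X). h X)"
      by (rule sum.cong) auto
    also have "(\<Sum>X | odd (k + card X). (-1) ^ (k + card X) * h X) = - (\<Sum>X | odd (k + card X). h X)"
      unfolding sum_negf[symmetric] by (rule sum.cong) auto
    finally show ?thesis by simp
  qed
  show "(\<Sum>S | head G2 S = v. ?s S) = (\<Sum>S | tail G2 S = v. ?s S)"
  proof (cases v)
    case (Inl A)
    have out: "(\<Sum>S | tail G2 S = v. ?s S) = (\<Sum>B | even (card A + card B). ?s (A <+> B))"
      by (rule sum.reindex_bij_witness[of _ "\<lambda>B. A <+> B" "\<lambda>S. Inr -` S"])
        (auto simp: G2_def Inl Plus_vimage_eq split: if_splits)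
    have inn: "(\<Sum>S | head G2 S = v. ?s S) = (\<Sum>B | odd (card A + card B). ?s (A <+> B))"
      by (rule sum.reindex_bij_witness[of _ "\<lambda>B. A <+> B" "\<lambda>S. Inr -` S"])
        (auto simp: G2_def Inl Plus_vimage_eq split: if_splits)
    have "(\<Sum>B\<in>UNIV. (-1) ^ (card A + card B) * ?s (A <+> B)) = 0"
      using alternating_slack_left[of q c A]
      by (simp add: power_add mult.assoc flip: sum_distrib_left)
    then show ?thesis unfolding out inn split by simp
  next
    case (Inr B)
    have out: "(\<Sum>S | tail G2 S = v. ?s S) = (\<Sum>A | odd (card B + card A). ?s (A <+> B))"
      by (rule sum.reindex_bij_witness[of _ "\<lambda>A. A <+> B" "\<lambda>S. Inl -` S"])
        (auto simp: G2_def Inr Plus_vimage_eq split: if_splits)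
    have inn: "(\<Sum>S | head G2 S = v. ?s S) = (\<Sum>A | even (card B + card A). ?s (A <+> B))"
      by (rule sum.reindex_bij_witness[of _ "\<lambda>A. A <+> B" "\<lambda>S. Inl -` S"])
        (auto simp: G2_def Inr Plus_vimage_eq split: if_splits)
    have "(\<Sum>A\<in>UNIV. (-1) ^ (card B + card A) * ?s (A <+> B)) = 0"
      using alternating_slack_right[of q c B]
      by (simp add: power_add mult.assoc flip: sum_distrib_left)
    then show ?thesis unfolding out inn split by simp
  qed
qed

section \<open>Circulations on a directed cycle\<close>

lemma walk_ends:
  assumes "pre_digraph.cas G u p w" and "p \<noteq> []"
  shows "tail G (hd p) = u" "head G (last p) = w"
  using assms
proof (induction p arbitrary: u)
  case (Cons a p)
  {
    case 1 then show ?case by (simp add: pre_digraph.cas.simps)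
  next
    case 2 then show ?case
      using Cons.IH(2) by (cases "p = []") (auto simp: pre_digraph.cas.simps)
  }
qed auto

lemma directed_cycle_walk:
  assumes "directed_cycle C"
  obtains u p where "pre_digraph.cas G2 u p u" "C = set p" "inj_on (head G2) C" "inj_on (tail G2) C"
proof -
  from assms obtain u p where p: "C = set p" "p \<noteq> []" "pre_digraph.cas G2 u p u"
    and dist: "distinct (tl (pre_digraph.awalk_verts G2 u p))"
    unfolding directed_cycle_def pre_digraph.cycle_def pre_digraph.awalk_def by blast
  have heads: "pre_digraph.awalk_verts G2 u p = tail G2 (hd p) # map (head G2) p"
    using pre_digraph.awalk_verts_conv'[OF p(3)] p(2) by simp
  have tails: "pre_digraph.awalk_verts G2 u p = map (tail G2) p @ [head G2 (last p)]"
    using p(2) by (simp add: pre_digraph.awalk_verts_conv)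
  have u: "tail G2 (hd p) = u" "head G2 (last p) = u"
    using walk_ends[OF p(3,2)] by simp_all
  \<comment> \<open>The heads are the tails shifted cyclically by one position.\<close>
  have "mset (map (tail G2) p) = mset (map (head G2) p)"
    using arg_cong[OF trans[OF heads[symmetric] tails], of mset] u by simp
  then have "distinct (map (tail G2) p)" "distinct (map (head G2) p)"
    using dist unfolding heads by (metis list.sel(3) mset_eq_imp_distinct_iff)+
  then show ?thesis
    using that[OF p(3,1)] p(1) by (simp add: distinct_map)
qed

lemma constant_on_walk:
  assumes "pre_digraph.cas G u p w"
    and "\<And>e e'. e \<in> set p \<Longrightarrow> e' \<in> set p \<Longrightarrow> head G e = tail G e' \<Longrightarrow> s e = s e'"
    and "e \<in> set p"
  shows "s e = s (hd p)"
  using assms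
proof (induction p arbitrary: u)
  case (Cons a es)
  show ?case
  proof (cases "es = []")
    case False
    then obtain b bs where es: "es = b # bs" by (cases es) auto
    have walk: "pre_digraph.cas G (head G a) es w"
      using Cons.prems(1) by (simp add: pre_digraph.cas.simps)
    then have "head G a = tail G b"
      by (simp add: es pre_digraph.cas.simps)
    then have "s a = s b"
      using Cons.prems(2)[of a b] es by simp
    moreover have "s e = s b" if "e \<in> set es"
      using Cons.IH[OF walk _ that] Cons.prems(2) es by simp
    ultimately show ?thesis using Cons.prems(3) by auto
  qed (use Cons.prems in simp)
qed simp

text \<open>
  All the flow that enters a vertex of the cycle arrives by the one arc of the cycle that ends there, and
  leaves by the one that starts there.
\<close>

lemma circulation_on_cycle:
  assumes cycle: "directed_cycle C" and circ: "circulation s"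
    and supp: "\<And>S. S \<notin> C \<Longrightarrow> s S = 0"
  obtains k where "\<And>S. s S = (if S \<in> C then k else 0)"
proof -
  obtain u p where p: "pre_digraph.cas G2 u p u" "C = set p"
    and inj: "inj_on (head G2) C" "inj_on (tail G2) C"
    using cycle by (rule directed_cycle_walk)
  have single: "(\<Sum>S | f S = f e. s S) = s e" if "e \<in> C" "inj_on f C"
    for e and f :: "('a + 'b) set \<Rightarrow> 'a set + 'b set"
  proof -
    have "(\<Sum>S | f S = f e. s S) = (\<Sum>S\<in>{e}. s S)"
      using that supp by (intro sum.mono_neutral_right) (auto dest: inj_onD)
    then show ?thesis by simp
  qed
  have "s e = s e'" if "e \<in> C" "e' \<in> C" "head G2 e = tail G2 e'" for e e'
  proof -
    have "s e = (\<Sum>S | head G2 S = head G2 e. s S)"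
      using single[OF that(1) inj(1)] by simp
    also have "\<dots> = (\<Sum>S | tail G2 S = tail G2 e'. s S)"
      using circ that(3) by (simp add: circulation_def)
    also have "\<dots> = s e'"
      using single[OF that(2) inj(2)] .
    finally show ?thesis .
  qed
  then have "s e = s (hd p)" if "e \<in> C" for e
    using constant_on_walk[OF p(1)] that unfolding p(2) by blast
  then show ?thesis
    using that[of "s (hd p)"] supp by auto
qed

section \<open>Facets and directed cycles\<close>

lemma cut_vector_in_GCut: "cut_vector K S \<in> GCut K"
  unfolding GCut_def by (rule hull_inc) simp

lemma GCut_halfspace:
  assumes "\<And>S. q \<bullet> cut_vector K S \<le> c" and "x \<in> GCut K"
  shows "q \<bullet> x \<le> c"
proof -
  have "GCut K \<subseteq> {x. q \<bullet> x \<le> c}"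
    unfolding GCut_def by (rule hull_minimal) (use assms in \<open>auto simp: convex_halfspace_le\<close>)
  with assms(2) show ?thesis by auto
qed

lemma GCut_hyperplane:
  assumes "\<And>S. q \<bullet> cut_vector K S = c" and "x \<in> GCut K"
  shows "q \<bullet> x = c"
proof -
  have "GCut K \<subseteq> {x. q \<bullet> x = c}"
    unfolding GCut_def by (rule hull_minimal) (use assms in \<open>auto simp: convex_hyperplane\<close>)
  with assms(2) show ?thesis by auto
qed

lemma polyhedron_GCut: "polyhedron (GCut K)"
  unfolding GCut_def by (intro polytope_imp_polyhedron polytope_convex_hull) simp

lemma slack_scale_eq: "slack_scale TYPE('m::finite + 'n::finite) = 2 ^ CARD('m + 'n) / 8"
proof -
  have "slack_scale TYPE('m + 'n) = 2 powi (int (CARD('m) + CARD('n)) - int 3)"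
    by (simp add: slack_scale_def)
  also have "\<dots> = 2 ^ CARD('m + 'n) / 8"
    by (subst power_int_diff) (simp_all only: power_int_of_nat card_UNIV_sum, simp_all)
  finally show ?thesis .
qed

lemma facet_slack_on_cycle:
  fixes C :: "('m::finite + 'n::finite) set set"
  assumes facet: "facet_defining D_complex F q c" and cof: "cofacet D_complex F = C"
    and cycle: "directed_cycle C" and norm: "normalized D_complex q c"
  shows "slack q c S = (if S \<in> C then slack_scale TYPE('m + 'n) else 0)"
proof -
  have "slack q c S = 0" if "S \<notin> C" for S
    using that facet unfolding cof[symmetric]
    by (simp add: cofacet_def facet_defining_def slack_def)
  then obtain k where k: "\<And>S. slack q c S = (if S \<in> C then k else 0)"
    using circulation_on_cycle[OF cycle circulation_slack] by blast
  have max: "Max (range (slack q c)) = slack_scale TYPE('m + 'n)"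
    using norm by (simp add: normalized_def slack_def)
  have "Max (range (slack q c)) \<in> range (slack q c)"
    by (rule Max_in) auto
  then obtain S' where S': "slack q c S' = slack_scale TYPE('m + 'n)"
    unfolding max by (auto dest: sym)
  moreover have "slack_scale TYPE('m + 'n) > 0"
    by (simp add: slack_scale_eq)
  ultimately have "k = slack_scale TYPE('m + 'n)"
    using k[of S'] by (auto split: if_splits)
  with k show ?thesis by simp
qed

lemma facet_defining_if_slack_on_cycle:
  fixes C :: "('m::finite + 'n::finite) set set"
  assumes cycle: "directed_cycle C" and proper: "C \<noteq> UNIV"
    and q: "q \<in> face_space D_complex" and "k > 0"
    and slack: "\<And>S. slack q c S = (if S \<in> C then k else 0)"
  shows "facet_defining D_complex {x \<in> GCut D_complex. q \<bullet> x = c} q c"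
    and "cofacet D_complex {x \<in> GCut D_complex. q \<bullet> x = c} = C"
proof -
  let ?K = "D_complex :: ('m + 'n) set set"
  let ?P = "GCut ?K" and ?d = "cut_vector ?K"
  let ?F = "{x \<in> ?P. q \<bullet> x = c}"
  have on_F: "?d S \<in> ?F \<longleftrightarrow> S \<notin> C" for S
    using slack[of S] \<open>k > 0\<close> cut_vector_in_GCut[of ?K S]
    by (auto simp: slack_def split: if_splits)
  show "cofacet ?K ?F = C"
    unfolding cofacet_def using on_F by auto
  have valid: "q \<bullet> x \<le> c" if "x \<in> ?P" for x
  proof (rule GCut_halfspace[OF _ that])
    fix S show "q \<bullet> ?d S \<le> c"
      using slack[of S] \<open>k > 0\<close> by (auto simp: slack_def split: if_splits)
  qed
  have face: "?F face_of ?P"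
    using face_of_Int_supporting_hyperplane_le[of ?P q c] valid
    by (simp add: GCut_def Int_def)
  have "C \<noteq> {}"
    using cycle by (auto simp: directed_cycle_def pre_digraph.cycle_def)
  then have "?F \<noteq> {}" "?F \<noteq> ?P"
    using on_F proper cut_vector_in_GCut[of ?K] by blast+
  then obtain F' where F': "F' facet_of ?P" "?F \<subseteq> F'"
    using face_of_polyhedron_subset_facet[OF polyhedron_GCut face] by blast
  then have "F' exposed_face_of ?P"
    by (simp add: exposed_face_of_polyhedron polyhedron_GCut facet_of_imp_face_of)
  then obtain q' c' where F'_eq: "F' = ?P \<inter> {x. q' \<bullet> x = c'}"
    unfolding exposed_face_of_def by blast
  have "slack q' c' S = 0" if "S \<notin> C" for S
    using that on_F[of S] F'(2) F'_eq by (auto simp: slack_def)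
  then obtain k' where k': "\<And>S. slack q' c' S = (if S \<in> C then k' else 0)"
    using circulation_on_cycle[OF cycle circulation_slack] by blast
  \<comment> \<open>The two slacks are proportional at the vertices, hence on the whole polytope.\<close>
  have proportional: "c' - q' \<bullet> x = k' / k * (c - q \<bullet> x)" if "x \<in> ?P" for x
  proof -
    have "(q' - (k' / k) *\<^sub>R q) \<bullet> x = c' - k' / k * c"
    proof (rule GCut_hyperplane[OF _ that])
      fix S
      have "c' - q' \<bullet> ?d S = k' / k * (c - q \<bullet> ?d S)"
        using slack[of S] k'[of S] \<open>k > 0\<close> by (simp add: slack_def split: if_splits)
      then show "(q' - (k' / k) *\<^sub>R q) \<bullet> ?d S = c' - k' / k * c"
        by (simp add: inner_diff_left right_diff_distrib)
    qed
    then show ?thesis by (simp add: inner_diff_left right_diff_distrib)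
  qed
  have "k' \<noteq> 0"
  proof
    assume "k' = 0"
    then have "F' = ?P" using proportional F'_eq by auto
    with F'(1) show False by simp
  qed
  then have "q' \<bullet> x = c' \<longleftrightarrow> q \<bullet> x = c" if "x \<in> ?P" for x
    using proportional[OF that] \<open>k > 0\<close> by auto
  then have "F' = ?F"
    unfolding F'_eq by blast
  with F'(1) valid q show "facet_defining ?K ?F q c"
    by (simp add: facet_defining_def)
qed

section \<open>The gluing functional\<close>

text \<open>
  Each of the two differences of signs is 0, $2$ or $-2$. The four parity patterns for which
  both are nonzero are those of the four sums in $\mathbf a$.
\<close>

lemma gluing_functional_nth:
  fixes A\<^sub>1 A\<^sub>2 :: "'m::finite set" and B\<^sub>1 B\<^sub>2 :: "'n::finite set"
  shows "gluing_functional A\<^sub>1 B\<^sub>1 A\<^sub>2 B\<^sub>2 $ F =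
    (parity_character F (Inl ` A\<^sub>1) - parity_character F (Inl ` A\<^sub>2)) *
    (parity_character F (Inr ` B\<^sub>2) - parity_character F (Inr ` B\<^sub>1)) / 4"
proof -
  have indicator: "(\<Sum>S\<in>X. axis S (1::real)) $ F = (if F \<in> X then 1 else 0)" for X
    by (simp add: axis_def)
  show ?thesis
    unfolding gluing_functional_def vector_add_component vector_minus_component indicator
    by (auto simp: parity_character_if P1_def P2_def N1_def N2_def)
qed

text \<open>
  If \<open>F\<close> contained all of $[m]$, it would meet \<open>A\<^sub>1\<close> and \<open>A\<^sub>2\<close> in sets of the same parity, and the
  coefficient at \<open>F\<close> would vanish; likewise for $[n]$.
\<close>

lemma gluing_functional_in_face_space:
  fixes A\<^sub>1 A\<^sub>2 :: "'m::finite set" and B\<^sub>1 B\<^sub>2 :: "'n::finite set"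
  assumes A: "even (card A\<^sub>1) \<longleftrightarrow> even (card A\<^sub>2)" and B: "even (card B\<^sub>1) \<longleftrightarrow> even (card B\<^sub>2)"
  shows "gluing_functional A\<^sub>1 B\<^sub>1 A\<^sub>2 B\<^sub>2 \<in> face_space D_complex"
proof -
  have "F \<in> nonempty_faces D_complex" if "gluing_functional A\<^sub>1 B\<^sub>1 A\<^sub>2 B\<^sub>2 $ F \<noteq> 0" for F
  proof -
    have A': "parity_character F (Inl ` A\<^sub>1) \<noteq> parity_character F (Inl ` A\<^sub>2)"
      and B': "parity_character F (Inr ` B\<^sub>1) \<noteq> parity_character F (Inr ` B\<^sub>2)"
      using that by (auto simp: gluing_functional_nth)
    have "Inl -` F \<noteq> UNIV"
    proof
      assume "Inl -` F = UNIV"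
      then have "F \<inter> Inl ` X = Inl ` X" for X by auto
      then have "card (F \<inter> Inl ` X) = card X" for X :: "'m set" by (simp add: card_image)
      with A A' show False by (simp add: parity_character_if)
    qed
    moreover have "Inr -` F \<noteq> UNIV"
    proof
      assume "Inr -` F = UNIV"
      then have "F \<inter> Inr ` X = Inr ` X" for X by auto
      then have "card (F \<inter> Inr ` X) = card X" for X :: "'n set" by (simp add: card_image)
      with B B' show False by (simp add: parity_character_if)
    qed
    moreover have "F \<noteq> {}" using A' by (auto simp: parity_character_if)
    ultimately show ?thesis
      using Plus_vimage_eq[of F] unfolding nonempty_faces_def D_complex_def by blast
  qed
  then show ?thesis unfolding face_space_def by blast
qed

lemma cut_vector_nth:
  assumes "F \<in> nonempty_faces K"
  shows "cut_vector K S $ F = (1 - parity_character F S) / 2"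
  using assms by (simp add: cut_vector_def parity_character_if)

text \<open>
  The four point masses come from orthogonality with the character of \<open>S\<close>, the values at \<open>{}\<close> from
  orthogonality with the constant term of \<open>d\<^sup>S\<close>. The factor 8 by which \<open>slack_scale\<close> falls short
  of the order of the group is the denominator 4 of \<open>gluing_functional_nth\<close> times the denominator 2 of
  \<open>cut_vector_nth\<close>.
\<close>

lemma gluing_functional_cut_vector:
  fixes A\<^sub>1 A\<^sub>2 :: "'m::finite set" and B\<^sub>1 B\<^sub>2 :: "'n::finite set" and S :: "('m + 'n) set"
  assumes A: "even (card A\<^sub>1) \<longleftrightarrow> even (card A\<^sub>2)" and B: "even (card B\<^sub>1) \<longleftrightarrow> even (card B\<^sub>2)"
  defines "\<delta> \<equiv> \<lambda>U. (of_bool (U = A\<^sub>1 <+> B\<^sub>2) + of_bool (U = A\<^sub>2 <+> B\<^sub>1)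
      - of_bool (U = A\<^sub>1 <+> B\<^sub>1) - of_bool (U = A\<^sub>2 <+> B\<^sub>2) :: real)"
  shows "gluing_functional A\<^sub>1 B\<^sub>1 A\<^sub>2 B\<^sub>2 \<bullet> cut_vector D_complex S =
    slack_scale TYPE('m + 'n) * (\<delta> {} - \<delta> S)"
proof -
  let ?a = "gluing_functional A\<^sub>1 B\<^sub>1 A\<^sub>2 B\<^sub>2"
  let ?x = "parity_character :: ('m + 'n) set \<Rightarrow> _"
  define e where "e F = ?x F (A\<^sub>1 <+> B\<^sub>2) + ?x F (A\<^sub>2 <+> B\<^sub>1) - ?x F (A\<^sub>1 <+> B\<^sub>1) - ?x F (A\<^sub>2 <+> B\<^sub>2)" for F
  have a: "?a $ F = e F / 4" for F
    by (simp add: gluing_functional_nth e_def parity_character_Plus algebra_simps)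
  have e: "(\<Sum>F\<in>UNIV. e F * ?x F U) = 2 ^ CARD('m + 'n) * \<delta> U" for U
    by (simp add: e_def \<delta>_def algebra_simps sum.distrib sum_subtractf parity_character_orthogonality
        del: card_UNIV_sum)
  have "?a $ F * cut_vector D_complex S $ F = (e F * ?x F {} - e F * ?x F S) / 8" for F
  proof (cases "F \<in> nonempty_faces (D_complex :: ('m + 'n) set set)")
    case True
    then show ?thesis by (simp add: a cut_vector_nth algebra_simps)
  next
    case False
    then have "e F = 0"
      using gluing_functional_in_face_space[OF A B] a[of F] by (simp add: face_space_def)
    then show ?thesis by (simp add: a)
  qed
  then have "?a \<bullet> cut_vector D_complex S = (\<Sum>F\<in>UNIV. (e F * ?x F {} - e F * ?x F S) / 8)"
    by (simp only: inner_vec_def inner_real_def)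
  also have "\<dots> = ((\<Sum>F\<in>UNIV. e F * ?x F {}) - (\<Sum>F\<in>UNIV. e F * ?x F S)) / 8"
    by (simp only: sum_subtractf sum_divide_distrib diff_divide_distrib)
  also have "\<dots> = slack_scale TYPE('m + 'n) * (\<delta> {} - \<delta> S)"
    unfolding e slack_scale_eq by (simp add: algebra_simps)
  finally show ?thesis .
qed

section \<open>Gluing two facets\<close>

lemma of_bool_exchange:
  assumes "X \<inter> Y = {}" "e \<in> X" "f \<in> Y" "g \<notin> X \<union> Y" "h \<notin> X \<union> Y" "g \<noteq> h"
  shows "of_bool (s \<in> X) + of_bool (s \<in> Y) + of_bool (s = g) + of_bool (s = h)
      - of_bool (s = e) - of_bool (s = f) = (of_bool (s \<in> (X \<union> Y \<union> {g, h}) - {e, f}) :: real)"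
  using assms by (cases "s \<in> X"; cases "s \<in> Y"; cases "s = g"; cases "s = h"; cases "s = e"; cases "s = f") auto

lemma arcs_of_disjoint_cycles:
  assumes "cycle_verts C\<^sub>1 \<inter> cycle_verts C\<^sub>2 = {}"
    and "A\<^sub>1 <+> B\<^sub>1 \<in> C\<^sub>1" and "A\<^sub>2 <+> B\<^sub>2 \<in> C\<^sub>2"
  shows "C\<^sub>1 \<inter> C\<^sub>2 = {}" and "A\<^sub>1 <+> B\<^sub>2 \<notin> C\<^sub>1 \<union> C\<^sub>2" and "A\<^sub>2 <+> B\<^sub>1 \<notin> C\<^sub>1 \<union> C\<^sub>2"
    and "A\<^sub>1 \<noteq> A\<^sub>2"
proof -
  have ends: "Inl A \<in> cycle_verts C" "Inr B \<in> cycle_verts C" if "A <+> B \<in> C" for A B C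
  proof -
    have "{Inl A, Inr B} = {tail G2 (A <+> B), head G2 (A <+> B)}" by (auto simp: G2_def)
    also have "\<dots> \<subseteq> cycle_verts C" using that by (auto simp: cycle_verts_def)
    finally show "Inl A \<in> cycle_verts C" "Inr B \<in> cycle_verts C" by auto
  qed
  show "C\<^sub>1 \<inter> C\<^sub>2 = {}"
    using assms(1) by (auto simp: cycle_verts_def)
  show "A\<^sub>1 <+> B\<^sub>2 \<notin> C\<^sub>1 \<union> C\<^sub>2" "A\<^sub>2 <+> B\<^sub>1 \<notin> C\<^sub>1 \<union> C\<^sub>2" "A\<^sub>1 \<noteq> A\<^sub>2"
    using assms(1) ends[OF assms(2)] ends[OF assms(3)] ends by blast+
qed

theorem theorem6p6:
  fixes C C\<^sub>1 C\<^sub>2 :: "('m::finite + 'n::finite) set set"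
    and A\<^sub>1 A\<^sub>2 :: "'m set" and B\<^sub>1 B\<^sub>2 :: "'n set"
    and F\<^sub>1 F\<^sub>2 :: "(real ^ ('m + 'n) set) set"
    and q\<^sub>1 q\<^sub>2 :: "real ^ ('m + 'n) set" and c\<^sub>1 :: real
  assumes "directed_cycle C"
    and "glued_along C C\<^sub>1 C\<^sub>2 A\<^sub>1 B\<^sub>1 A\<^sub>2 B\<^sub>2"
    and "facet_defining D_complex F\<^sub>1 q\<^sub>1 c\<^sub>1" and "cofacet D_complex F\<^sub>1 = C\<^sub>1"
    and "normalized D_complex q\<^sub>1 c\<^sub>1"
    and "facet_defining D_complex F\<^sub>2 q\<^sub>2 0" and "cofacet D_complex F\<^sub>2 = C\<^sub>2"
    and "normalized D_complex q\<^sub>2 0"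
  shows "(c\<^sub>1 = slack_scale TYPE('m + 'n) \<or> c\<^sub>1 = 0) \<and>
    (keeps_empty_arc A\<^sub>1 B\<^sub>1 A\<^sub>2 B\<^sub>2 \<longrightarrow>
      (\<exists>F. facet_defining D_complex F (q\<^sub>1 + q\<^sub>2 + gluing_functional A\<^sub>1 B\<^sub>1 A\<^sub>2 B\<^sub>2) c\<^sub>1 \<and>
           cofacet D_complex F = C) \<and>
      normalized D_complex (q\<^sub>1 + q\<^sub>2 + gluing_functional A\<^sub>1 B\<^sub>1 A\<^sub>2 B\<^sub>2) c\<^sub>1 \<and>
      (\<forall>S. (q\<^sub>1 + q\<^sub>2 + gluing_functional A\<^sub>1 B\<^sub>1 A\<^sub>2 B\<^sub>2) \<bullet> cut_vector D_complex S
             \<in> {c\<^sub>1, c\<^sub>1 - slack_scale TYPE('m + 'n)}))"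
proof -
  let ?a = "gluing_functional A\<^sub>1 B\<^sub>1 A\<^sub>2 B\<^sub>2" and ?k = "slack_scale TYPE('m + 'n)"
  let ?q = "q\<^sub>1 + q\<^sub>2 + ?a"
  have glue: "directed_cycle C\<^sub>1" "directed_cycle C\<^sub>2" "cycle_verts C\<^sub>1 \<inter> cycle_verts C\<^sub>2 = {}"
      "A\<^sub>1 <+> B\<^sub>1 \<in> C\<^sub>1" "A\<^sub>2 <+> B\<^sub>2 \<in> C\<^sub>2"
      "even (card A\<^sub>1) \<longleftrightarrow> even (card A\<^sub>2)" "even (card B\<^sub>1) \<longleftrightarrow> even (card B\<^sub>2)"
      "C = (C\<^sub>1 \<union> C\<^sub>2 \<union> {A\<^sub>1 <+> B\<^sub>2, A\<^sub>2 <+> B\<^sub>1}) - {A\<^sub>1 <+> B\<^sub>1, A\<^sub>2 <+> B\<^sub>2}"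
    using assms(2) unfolding glued_along_def by blast+
  note disj = arcs_of_disjoint_cycles[OF glue(3-5)]
  have slack1: "slack q\<^sub>1 c\<^sub>1 S = (if S \<in> C\<^sub>1 then ?k else 0)" for S
    by (rule facet_slack_on_cycle[OF assms(3,4) glue(1) assms(5)])
  have slack2: "slack q\<^sub>2 0 S = (if S \<in> C\<^sub>2 then ?k else 0)" for S
    by (rule facet_slack_on_cycle[OF assms(6,7) glue(2) assms(8)])
  have pos: "?k > 0" by (simp add: slack_scale_eq)
  have c1: "c\<^sub>1 = ?k \<or> c\<^sub>1 = 0"
    using slack1[of "{}"] by (simp add: slack_empty split: if_splits)
  have rest: "(\<exists>F. facet_defining D_complex F ?q c\<^sub>1 \<and> cofacet D_complex F = C) \<and>
      normalized D_complex ?q c\<^sub>1 \<and>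
      (\<forall>S. ?q \<bullet> cut_vector D_complex S \<in> {c\<^sub>1, c\<^sub>1 - ?k})"
    if keeps: "keeps_empty_arc A\<^sub>1 B\<^sub>1 A\<^sub>2 B\<^sub>2"
  proof -
    \<comment> \<open>The right-hand side 0 of the second inequality says that its slack at the arc \<open>{}\<close> is 0.\<close>
    have "{} \<notin> C\<^sub>2"
      using slack2[of "{}"] pos by (simp add: slack_empty split: if_splits)
    then have "{} \<noteq> A\<^sub>2 <+> B\<^sub>2"
      using glue(5) by metis
    moreover have "{} \<noteq> A\<^sub>1 <+> B\<^sub>1" "{} \<noteq> A\<^sub>1 <+> B\<^sub>2" "{} \<noteq> A\<^sub>2 <+> B\<^sub>1"
      using keeps by (simp_all only: keeps_empty_arc_def insert_iff de_Morgan_disj not_False_eq_True)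
    ultimately have empty: "{} \<noteq> A\<^sub>1 <+> B\<^sub>1" "{} \<noteq> A\<^sub>1 <+> B\<^sub>2" "{} \<noteq> A\<^sub>2 <+> B\<^sub>1" "{} \<noteq> A\<^sub>2 <+> B\<^sub>2"
      by - assumption+
    have arcs: "A\<^sub>1 <+> B\<^sub>2 \<noteq> A\<^sub>2 <+> B\<^sub>1"
      using disj(4) by (metis vimage_Plus(1))
    have slack: "slack ?q c\<^sub>1 S = (if S \<in> C then ?k else 0)" for S
    proof -
      have "slack ?q c\<^sub>1 S = slack q\<^sub>1 c\<^sub>1 S + slack q\<^sub>2 0 S - ?a \<bullet> cut_vector D_complex S"
        by (simp add: slack_def inner_add_left)
      also have "\<dots> = ?k * (of_bool (S \<in> C\<^sub>1) + of_bool (S \<in> C\<^sub>2)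
          + of_bool (S = A\<^sub>1 <+> B\<^sub>2) + of_bool (S = A\<^sub>2 <+> B\<^sub>1)
          - of_bool (S = A\<^sub>1 <+> B\<^sub>1) - of_bool (S = A\<^sub>2 <+> B\<^sub>2))"
        using empty by (simp add: slack1 slack2 gluing_functional_cut_vector[OF glue(6,7)] algebra_simps)
      also have "\<dots> = (if S \<in> C then ?k else 0)"
        unfolding glue(8) of_bool_exchange[OF disj(1) glue(4,5) disj(2,3) arcs] by simp
      finally show ?thesis .
    qed
    have C: "A\<^sub>1 <+> B\<^sub>2 \<in> C" "A\<^sub>1 <+> B\<^sub>1 \<notin> C"
      unfolding glue(8) using disj(2) glue(4,5) by auto
    have "?q \<in> face_space D_complex"
      using assms(3,6) gluing_functional_in_face_space[OF glue(6,7)]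
      by (simp add: facet_defining_def face_space_def)
    then have facet: "facet_defining D_complex {x \<in> GCut D_complex. ?q \<bullet> x = c\<^sub>1} ?q c\<^sub>1"
        "cofacet D_complex {x \<in> GCut D_complex. ?q \<bullet> x = c\<^sub>1} = C"
      using facet_defining_if_slack_on_cycle[OF assms(1) _ _ pos slack] C by auto
    have "range (slack ?q c\<^sub>1) = {?k, 0}"
      using C by (auto simp: slack image_iff)
    then have "normalized D_complex ?q c\<^sub>1"
      using pos by (simp add: normalized_def flip: slack_def)
    moreover have "?q \<bullet> cut_vector D_complex S \<in> {c\<^sub>1, c\<^sub>1 - ?k}" for S
      using slack[of S] by (auto simp: slack_def split: if_splits)
    ultimately show ?thesis using facet by blast
  qed
  from c1 rest show ?thesis by blast
qed

end
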